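(* Let $\mathsf{A}_e,\mathsf{A}_h\subset GL_2(\mathbb{R})$ be such that (1) $\mathsf{A}_h$ is nonempty, compact, and has a strongly invariant multicone $\mathcal{C}$, (2) $\mathsf{A}_e$ is strongly conformal and $A\mathcal{C}=\mathcal{C}$ for all $A\in\mathsf{A}_e$. Then the semigroup $\mathcal{S}(\mathsf{A}_e\cup\mathsf{A}_h)$ generated by $\mathsf{A}_e\cup\mathsf{A}_h$ is almost multiplicative.
   Context: $\|\cdot\|$ is the operator norm. A semigroup $\mathcal{S}\subset GL_2(\mathbb{R})$ is almost multiplicative if there is $\kappa>0$ with $\|AB\|\ge\kappa\|A\|\|B\|$ for all $A,B\in\mathcal{S}$. A set is strongly conformal if there is a single invertible $M$ with $|\det A|^{-1/2}MAM^{-1}\in O(2)$ for all $A$ in the set. $\mathbb{RP}^1$ is the real projective line; a multicone is a proper subset of $\mathbb{RP}^1$ that is a finite union of closed projective intervals; it is strongly invariant for a set $\mathsf{B}$ if $A\mathcal{C}\subset\mathcal{C}^o$ (interior) for all $A\in\mathsf{B}$. *)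

theory Defs
  imports "HOL-Analysis.Analysis"
begin

type_synonym mat2 = "real^2^2"

text \<open>Operator norm of a 2x2 real matrix (as a linear map on the Euclidean plane).\<close>
definition opnorm :: "mat2 \<Rightarrow> real" where
  "opnorm A = onorm (\<lambda>x. A *v x)"

text \<open>GL_2(R).\<close>
definition GL2 :: "mat2 set" where
  "GL2 = {A. invertible A}"

text \<open>Semigroup generated by a set of matrices (all finite nonempty products).\<close>
inductive_set semigroup_gen :: "mat2 set \<Rightarrow> mat2 set" for B :: "mat2 set" where
  gen: "A \<in> B \<Longrightarrow> A \<in> semigroup_gen B"
| mult: "A \<in> semigroup_gen B \<Longrightarrow> C \<in> semigroup_gen B \<Longrightarrow> A ** C \<in> semigroup_gen B"

definition almost_multiplicative :: "mat2 set \<Rightarrow> bool" where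
  "almost_multiplicative S \<longleftrightarrow>
     (\<exists>\<kappa>>0. \<forall>A\<in>S. \<forall>B\<in>S. opnorm (A ** B) \<ge> \<kappa> * opnorm A * opnorm B)"

definition strongly_conformal :: "mat2 set \<Rightarrow> bool" where
  "strongly_conformal B \<longleftrightarrow>
     (\<exists>M::mat2. invertible M \<and>
        (\<forall>A\<in>B. orthogonal_matrix ((1 / sqrt \<bar>det A\<bar>) *\<^sub>R (M ** A ** matrix_inv M))))"

text \<open>Subsets of the real projective line RP^1 are represented by their cones:
  sets of nonzero vectors in R^2 closed under multiplication by nonzero scalars.
  The closed projective interval with (distinct) endpoints [u], [v] is the set of
  lines through the segment from u to v (u, v linearly independent).\<close>
definition proj_interval :: "real^2 \<Rightarrow> real^2 \<Rightarrow> (real^2) set" where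
  "proj_interval u v = {t *\<^sub>R w | t w. t \<noteq> 0 \<and> w \<in> closed_segment u v}"

definition all_lines :: "(real^2) set" where
  "all_lines = UNIV - {0}"

definition multicone :: "(real^2) set \<Rightarrow> bool" where
  "multicone C \<longleftrightarrow>
     (\<exists>I. finite I \<and> I \<noteq> {} \<and>
        (\<forall>(u, v)\<in>I. \<not> collinear {0, u, v}) \<and>
        C = (\<Union>(u, v)\<in>I. proj_interval u v)) \<and>
     C \<subset> all_lines"

text \<open>Interior in RP^1 of a cone corresponds to the interior of the cone in R^2.\<close>
definition strongly_invariant :: "mat2 set \<Rightarrow> (real^2) set \<Rightarrow> bool" where
  "strongly_invariant B C \<longleftrightarrow> (\<forall>A\<in>B. (\<lambda>x. A *v x) ` C \<subseteq> interior C)"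

end

theory Submission
  imports Defs
begin

text \<open>
  Conjugated by the matrix M of strong conformality, every product of elements of \<open>A\<^sub>e\<close> is a
  similarity, so it satisfies \<open>\<parallel>E x\<parallel> \<ge> k \<parallel>E\<parallel> \<parallel>x\<parallel>\<close> for all x. Any other element of the
  semigroup factors as \<open>T H E\<close> with \<open>H \<in> A\<^sub>h\<close> its last hyperbolic letter, E a product of
  conformal letters (or 1) and T preserving the multicone C. By compactness, H maps the
  directions of C uniformly deep into the interior of C, and a linear map preserving a cone
  that avoids a line has its norm controlled, up to a constant depending only on that depth,
  by its value at any direction deep inside. Hence \<open>\<parallel>S w\<parallel> \<ge> c \<parallel>S\<parallel> \<parallel>w\<parallel>\<close> uniformly for
  all S in the semigroup and w in C, and evaluating \<open>A B\<close> at a vector of C gives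
  \<open>\<parallel>A B\<parallel> \<ge> c\<^sup>2 \<parallel>A\<parallel> \<parallel>B\<parallel>\<close>.
\<close>

lemma opnorm_mult_vec: "norm (A *v x) \<le> opnorm A * norm x"
  unfolding opnorm_def by (rule onorm) simp

lemma opnorm_nonneg: "0 \<le> opnorm A"
  unfolding opnorm_def by (rule onorm_pos_le) simp

lemma opnorm_le: "(\<And>x. norm (A *v x) \<le> b * norm x) \<Longrightarrow> opnorm A \<le> b"
  unfolding opnorm_def by (rule onorm_le)

lemma opnorm_matrix_mult: "opnorm (A ** B) \<le> opnorm A * opnorm B"
proof -
  have "(\<lambda>x. (A ** B) *v x) = (\<lambda>x. A *v x) \<circ> (\<lambda>x. B *v x)"
    by (auto simp: matrix_vector_mul_assoc)
  then show ?thesis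
    unfolding opnorm_def by (metis onorm_compose matrix_vector_mul_bounded_linear)
qed

lemma opnorm_le_norm: "opnorm A \<le> 4 * norm A"
proof -
  have "opnorm A \<le> real CARD(2) * real CARD(2) * norm A"
    unfolding opnorm_def
    by (rule onorm_le_matrix_component)
      (rule order_trans[OF component_le_norm_cart Finite_Cartesian_Product.norm_nth_le])
  then show ?thesis by simp
qed

lemma invertible_mult_vec_eq_0_iff:
  fixes A :: "'a::field^'n^'n"
  assumes "invertible A"
  shows "A *v x = 0 \<longleftrightarrow> x = 0"
  by (metis assms injD inj_matrix_vector_mult matrix_vector_mult_0_right)

lemma compact_GL2_uniform_lower_bound:
  assumes "compact K" "K \<subseteq> GL2"
  shows "\<exists>m>0. \<forall>H\<in>K. \<forall>x. m * norm x \<le> norm (H *v x)"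
proof (cases "K = {}")
  case False
  let ?S = "K \<times> sphere (0::real^2) 1"
  have "compact ?S" using assms(1) by (intro compact_Times) auto
  moreover have "?S \<noteq> {}"
    using False by (auto intro!: exI[of _ "axis 1 1"])
  moreover have "continuous_on ?S (\<lambda>p. norm (fst p *v snd p))"
    unfolding matrix_vector_mult_def by (intro continuous_intros)
  ultimately obtain p where p: "p \<in> ?S" "\<forall>q\<in>?S. norm (fst p *v snd p) \<le> norm (fst q *v snd q)"
    using continuous_attains_inf by blast
  have "fst p *v snd p \<noteq> 0"
    using p(1) assms(2) invertible_mult_vec_eq_0_iff unfolding GL2_def by fastforce
  then have pos: "norm (fst p *v snd p) > 0" by simp
  have "norm (fst p *v snd p) * norm x \<le> norm (H *v x)" if "H \<in> K" for H x
  proof (cases "x = 0")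
    case False
    then have "norm (fst p *v snd p) \<le> norm (H *v sgn x)"
      using p(2) that by (auto simp: norm_sgn)
    also have "\<dots> = norm (H *v x) / norm x"
      by (simp add: sgn_div_norm matrix_vector_mult_scaleR divide_inverse mult.commute)
    finally show ?thesis using False by (simp add: field_simps)
  qed simp
  then show ?thesis using pos by blast
qed (auto intro: exI[of _ 1])

lemma multicone_scaleR:
  assumes "multicone C" "x \<in> C" "t \<noteq> 0"
  shows "t *\<^sub>R x \<in> C"
proof -
  obtain I where I: "C = (\<Union>(u, v)\<in>I. proj_interval u v)"
    using assms(1) unfolding multicone_def by blast
  from assms(2) obtain u v where uv: "(u, v) \<in> I" "x \<in> proj_interval u v"
    unfolding I by blast
  then obtain s w where "s \<noteq> 0" "w \<in> closed_segment u v" "x = s *\<^sub>R w"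
    unfolding proj_interval_def by blast
  then have "t *\<^sub>R x \<in> proj_interval u v"
    unfolding proj_interval_def using assms(3) by (auto intro!: exI[of _ "t * s"])
  then show ?thesis using uv(1) unfolding I by blast
qed

lemma multicone_zero: "multicone C \<Longrightarrow> 0 \<notin> C"
  unfolding multicone_def all_lines_def by blast

lemma multicone_sgn:
  assumes "multicone C" "x \<in> C"
  shows "sgn x \<in> C"
proof -
  have "x \<noteq> 0" using assms multicone_zero by blast
  then show ?thesis
    using multicone_scaleR[OF assms, of "inverse (norm x)"] by (simp add: sgn_div_norm)
qed

lemma closed_segment_subset_proj_interval: "closed_segment u v \<subseteq> proj_interval u v"
  unfolding proj_interval_def by (force intro: exI[of _ 1])

lemma multicone_unit_vector:
  assumes "multicone C"
  shows "\<exists>w\<in>C. norm w = 1"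
proof -
  obtain I where I: "C = (\<Union>(u, v)\<in>I. proj_interval u v)" and "I \<noteq> {}"
    using assms unfolding multicone_def by blast
  then obtain u v where "(u, v) \<in> I" by auto
  with I have "u \<in> C" using closed_segment_subset_proj_interval by blast
  moreover from this have "u \<noteq> 0" using multicone_zero[OF assms] by auto
  ultimately show ?thesis
    using multicone_sgn[OF assms] by (intro bexI[of _ "sgn u"]) (simp_all add: norm_sgn)
qed

lemma compact_multicone_sphere:
  assumes "multicone C"
  shows "compact (C \<inter> sphere 0 1)"
proof -
  obtain I where fin: "finite I" and I: "C = (\<Union>(u, v)\<in>I. proj_interval u v)"
    using assms unfolding multicone_def by blast
  have "compact (proj_interval u v \<inter> sphere 0 1)" if uv: "(u, v) \<in> I" for u v
  proof -
    let ?f = "\<lambda>p::real \<times> (real^2). fst p *\<^sub>R sgn (snd p)"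
    have "0 \<notin> closed_segment u v"
      using closed_segment_subset_proj_interval uv multicone_zero[OF assms] unfolding I by blast
    then have "continuous_on ({-1, 1} \<times> closed_segment u v) ?f"
      by (intro continuous_intros) auto
    then have "compact (?f ` ({-1, 1} \<times> closed_segment u v))"
      by (intro compact_continuous_image compact_Times) auto
    moreover have "proj_interval u v \<inter> sphere 0 1 = ?f ` ({-1, 1} \<times> closed_segment u v)"
    proof (intro set_eqI iffI)
      fix x assume "x \<in> proj_interval u v \<inter> sphere 0 1"
      then obtain t w where tw: "t \<noteq> 0" "w \<in> closed_segment u v" "x = t *\<^sub>R w" "\<bar>t\<bar> * norm w = 1"
        unfolding proj_interval_def by auto
      then have "x = sgn t *\<^sub>R sgn w"
        by (simp add: sgn_div_norm sgn_if field_simps abs_if split: if_splits)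
      then show "x \<in> ?f ` ({-1, 1} \<times> closed_segment u v)"
        using tw by (auto simp: sgn_if intro!: image_eqI[of _ _ "(sgn t, w)"])
    next
      fix x assume "x \<in> ?f ` ({-1, 1} \<times> closed_segment u v)"
      then obtain t w where tw: "t \<in> {-1, 1}" "w \<in> closed_segment u v" "x = t *\<^sub>R sgn w"
        by force
      with \<open>0 \<notin> closed_segment u v\<close> have "w \<noteq> 0" by auto
      with tw have "x = (t / norm w) *\<^sub>R w" "t / norm w \<noteq> 0" "norm x = 1"
        by (auto simp: sgn_div_norm norm_sgn inverse_eq_divide)
      moreover have "x \<in> proj_interval u v"
        unfolding proj_interval_def using tw(2) calculation(1,2) by blast
      ultimately show "x \<in> proj_interval u v \<inter> sphere 0 1" by simp
    qed
    ultimately show ?thesis by simp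
  qed
  moreover have "C \<inter> sphere 0 1 = (\<Union>(u, v)\<in>I. proj_interval u v \<inter> sphere 0 1)"
    unfolding I by auto
  ultimately show ?thesis using fin by (auto intro!: compact_UN)
qed

lemma orthogonal_rot90_imp_parallel:
  fixes x z :: "real^2"
  assumes "x \<noteq> 0" "(\<chi> i. if i = 1 then - (z$2) else z$1) \<bullet> x = 0"
  shows "z = ((z \<bullet> x) / (x \<bullet> x)) *\<^sub>R x"
proof -
  have "x \<bullet> x \<noteq> 0" using assms(1) by simp
  moreover have "z$2 * x$1 = z$1 * x$2" using assms(2) by (simp add: inner_vec_def sum_2)
  ultimately show ?thesis
    by (simp add: vec_eq_iff forall_2 inner_vec_def sum_2 field_simps)
qed

lemma multicone_norm_le_functional:
  assumes "multicone C"
  shows "\<exists>n c. c > 0 \<and> (\<forall>x\<in>C. norm x \<le> c * \<bar>n \<bullet> x\<bar>)"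
proof -
  obtain z where z: "z \<noteq> 0" "z \<notin> C"
    using assms unfolding multicone_def all_lines_def by blast
  define n :: "real^2" where "n = (\<chi> i. if i = 1 then - (z$2) else z$1)"
  have n_nonzero: "n \<bullet> x \<noteq> 0" if "x \<in> C" for x
  proof
    assume "n \<bullet> x = 0"
    moreover have "x \<noteq> 0" using that multicone_zero[OF assms] by auto
    ultimately have "z = ((z \<bullet> x) / (x \<bullet> x)) *\<^sub>R x"
      using orthogonal_rot90_imp_parallel unfolding n_def by blast
    then show False using z multicone_scaleR[OF assms that] by (metis scale_zero_left)
  qed
  let ?K = "C \<inter> sphere 0 1"
  have "?K \<noteq> {}" using multicone_unit_vector[OF assms] by auto
  moreover have "continuous_on ?K (\<lambda>x. \<bar>n \<bullet> x\<bar>)" by (intro continuous_intros)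
  ultimately obtain x0 where x0: "x0 \<in> ?K" "\<forall>y\<in>?K. \<bar>n \<bullet> x0\<bar> \<le> \<bar>n \<bullet> y\<bar>"
    using continuous_attains_inf[OF compact_multicone_sphere[OF assms]] by blast
  have pos: "\<bar>n \<bullet> x0\<bar> > 0" using n_nonzero x0(1) by auto
  have "\<bar>n \<bullet> x0\<bar> * norm x \<le> \<bar>n \<bullet> x\<bar>" if "x \<in> C" for x
  proof -
    have "x \<noteq> 0" using that multicone_zero[OF assms] by auto
    then have "sgn x \<in> ?K"
      using multicone_sgn[OF assms that] by (simp add: norm_sgn)
    then have "\<bar>n \<bullet> x0\<bar> \<le> \<bar>n \<bullet> sgn x\<bar>" using x0(2) by blast
    also have "\<dots> = \<bar>n \<bullet> x\<bar> / norm x" by (simp add: sgn_div_norm abs_mult field_simps)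
    finally show ?thesis using \<open>x \<noteq> 0\<close> by (simp add: field_simps)
  qed
  then show ?thesis
    using pos by (intro exI[of _ n] exI[of _ "1 / \<bar>n \<bullet> x0\<bar>"]) (auto simp: field_simps)
qed

lemma interior_multicone_scaleR:
  assumes "multicone C" "z \<in> interior C" "t \<noteq> 0"
  shows "t *\<^sub>R z \<in> interior C"
proof -
  have "(*\<^sub>R) t ` C = C"
  proof
    show "(*\<^sub>R) t ` C \<subseteq> C" using multicone_scaleR[OF assms(1) _ assms(3)] by blast
    show "C \<subseteq> (*\<^sub>R) t ` C"
    proof
      fix x assume "x \<in> C"
      then have "inverse t *\<^sub>R x \<in> C" using multicone_scaleR[OF assms(1)] assms(3) by simp
      moreover have "x = t *\<^sub>R (inverse t *\<^sub>R x)" using assms(3) by simp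
      ultimately show "x \<in> (*\<^sub>R) t ` C" by blast
    qed
  qed
  then have "interior C = (*\<^sub>R) t ` interior C"
    using assms(3) by (metis interior_injective_linear_image linear_scaleR inj_on_def scaleR_cancel_left)
  with assms(2) show ?thesis by blast
qed

lemma abs_add_abs_diff_eq_if_no_root:
  fixes \<alpha> \<beta> \<rho> :: real
  assumes "0 \<le> \<rho>" and no_root: "\<And>s. \<bar>s\<bar> \<le> \<rho> \<Longrightarrow> \<alpha> + s * \<beta> \<noteq> 0"
  shows "\<bar>\<alpha> + \<rho> * \<beta>\<bar> + \<bar>\<alpha> - \<rho> * \<beta>\<bar> = 2 * \<bar>\<alpha>\<bar>"
proof -
  have "\<bar>\<rho> * \<beta>\<bar> < \<bar>\<alpha>\<bar>"
  proof (cases "\<beta> = 0")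
    case True
    then show ?thesis using no_root[of 0] \<open>0 \<le> \<rho>\<close> by simp
  next
    case False
    then have "\<not> \<bar>- \<alpha> / \<beta>\<bar> \<le> \<rho>" using no_root[of "- \<alpha> / \<beta>"] by auto
    then show ?thesis using \<open>0 \<le> \<rho>\<close> False by (simp add: abs_mult field_simps)
  qed
  then show ?thesis by arith
qed

lemma norm_linear_le_at_ball_center:
  fixes f :: "'a::real_inner \<Rightarrow> 'a"
  assumes f: "linear f" "f ` C \<subseteq> C"
    and transversal: "\<forall>x\<in>C. norm x \<le> c * \<bar>n \<bullet> x\<bar>" and "0 \<le> c"
    and "0 \<notin> C" and ball: "ball y r \<subseteq> C" and "r > 0"
  shows "norm (f v) \<le> 2 * c * norm n / r * norm (f y) * norm v"
proof (cases "v = 0")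
  case False
  define \<rho> where "\<rho> = r / (2 * norm v)"
  have \<rho>: "\<rho> > 0" using \<open>r > 0\<close> False unfolding \<rho>_def by simp
  define \<alpha> \<beta> where "\<alpha> = n \<bullet> f y" and "\<beta> = n \<bullet> f v"
  have lin: "f (y + s *\<^sub>R v) = f y + s *\<^sub>R f v" for s
    using f(1) by (simp add: linear_add linear_scale)
  have lin_diff: "f (y - s *\<^sub>R v) = f y - s *\<^sub>R f v" for s
    using f(1) by (simp add: linear_diff linear_scale)
  have in_C: "f (y + s *\<^sub>R v) \<in> C" if "\<bar>s\<bar> \<le> \<rho>" for s
  proof -
    have "dist y (y + s *\<^sub>R v) \<le> \<rho> * norm v"
      using that by (simp add: dist_norm mult_right_mono)
    also have "\<dots> < r" using \<open>r > 0\<close> False unfolding \<rho>_def by simp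
    finally have "y + s *\<^sub>R v \<in> C" using ball by auto
    then show ?thesis using f(2) by blast
  qed
  \<comment> \<open>n has no zero on C, hence none along the segment from \<open>f (y - \<rho> v)\<close> to \<open>f (y + \<rho> v)\<close>:
    the two endpoints have n-values of the same sign.\<close>
  have no_root: "\<alpha> + s * \<beta> \<noteq> 0" if "\<bar>s\<bar> \<le> \<rho>" for s
  proof
    assume "\<alpha> + s * \<beta> = 0"
    then have "norm (f (y + s *\<^sub>R v)) \<le> 0"
      using transversal in_C[OF that] lin unfolding \<alpha>_def \<beta>_def by (auto simp: inner_add_right)
    then show False using in_C[OF that] \<open>0 \<notin> C\<close> by simp
  qed
  have sum: "\<bar>\<alpha> + \<rho> * \<beta>\<bar> + \<bar>\<alpha> - \<rho> * \<beta>\<bar> = 2 * \<bar>\<alpha>\<bar>"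
    using \<rho> no_root by (intro abs_add_abs_diff_eq_if_no_root) auto
  have "2 * \<rho> * norm (f v) = norm (f (y + \<rho> *\<^sub>R v) - f (y - \<rho> *\<^sub>R v))"
    using \<rho> unfolding lin lin_diff by (simp add: scaleR_left_distrib[symmetric])
  also have "\<dots> \<le> norm (f (y + \<rho> *\<^sub>R v)) + norm (f (y - \<rho> *\<^sub>R v))"
    by (rule norm_triangle_ineq4)
  also have "\<dots> \<le> c * \<bar>\<alpha> + \<rho> * \<beta>\<bar> + c * \<bar>\<alpha> - \<rho> * \<beta>\<bar>"
    using transversal in_C[of \<rho>] in_C[of "- \<rho>"] \<rho> lin lin_diff
    unfolding \<alpha>_def \<beta>_def by (intro add_mono) (auto simp: inner_add_right inner_diff_right)
  also have "\<dots> = 2 * c * \<bar>\<alpha>\<bar>" using sum by (metis distrib_left mult.assoc mult.commute)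
  also have "\<dots> \<le> 2 * c * (norm n * norm (f y))"
    unfolding \<alpha>_def using \<open>0 \<le> c\<close> by (intro mult_left_mono Cauchy_Schwarz_ineq2) auto
  finally show ?thesis
    using \<rho> \<open>r > 0\<close> False unfolding \<rho>_def by (simp add: field_simps)
qed (simp add: linear_0[OF f(1)])

lemma opnorm_mult_norm_le_at_interior_direction:
  assumes "(*v) T ` C \<subseteq> C" "\<forall>x\<in>C. norm x \<le> c * \<bar>n \<bullet> x\<bar>" "0 \<le> c" "0 \<notin> C"
    and "ball (sgn y) r \<subseteq> C" "r > 0"
  shows "opnorm T * norm y \<le> 2 * c * norm n / r * norm (T *v y)"
proof (cases "y = 0")
  case False
  have "opnorm T \<le> 2 * c * norm n / r * norm (T *v sgn y)"
    by (intro opnorm_le norm_linear_le_at_ball_center[OF matrix_vector_mul_linear assms])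
  also have "norm (T *v sgn y) = norm (T *v y) / norm y"
    by (simp add: sgn_div_norm matrix_vector_mult_scaleR divide_inverse mult.commute)
  finally show ?thesis using False \<open>r > 0\<close> by (simp add: divide_simps ac_simps)
qed simp

lemma strongly_invariant_uniform_ball:
  assumes C: "multicone C" and "strongly_invariant K C" "compact K" "K \<subseteq> GL2"
  shows "\<exists>r>0. \<forall>H\<in>K. \<forall>x\<in>C. ball (sgn (H *v x)) r \<subseteq> C"
proof -
  let ?S = "K \<times> (C \<inter> sphere 0 1)"
  let ?f = "\<lambda>p::mat2 \<times> (real^2). sgn (fst p *v snd p)"
  have nonzero: "fst p *v snd p \<noteq> 0" if "p \<in> ?S" for p
    using that assms(4) invertible_mult_vec_eq_0_iff unfolding GL2_def by fastforce
  have "continuous_on ?S (\<lambda>p. fst p *v snd p)"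
    unfolding matrix_vector_mult_def by (intro continuous_intros)
  then have "continuous_on ?S ?f"
    using nonzero by (intro continuous_on_sgn) auto
  then have compact_image: "compact (?f ` ?S)"
    using assms(3) compact_multicone_sphere[OF C] by (intro compact_continuous_image compact_Times)
  have image_interior: "?f ` ?S \<subseteq> interior C"
  proof clarify
    fix H x assume "H \<in> K" "x \<in> C" "x \<in> sphere 0 1"
    then have "H *v x \<in> interior C" "H *v x \<noteq> 0"
      using assms(2) nonzero[of "(H, x)"] unfolding strongly_invariant_def by auto
    then show "?f (H, x) \<in> interior C"
      using interior_multicone_scaleR[OF C] by (simp add: sgn_div_norm)
  qed
  obtain r where r: "r > 0" "(\<Union>y\<in>?f ` ?S. ball y r) \<subseteq> interior C"
    using compact_subset_open_imp_ball_epsilon_subset[OF compact_image open_interior image_interior] .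
  have "ball (sgn (H *v x)) r \<subseteq> C" if "H \<in> K" "x \<in> C" for H x
  proof -
    have "x \<noteq> 0" using that multicone_zero[OF C] by auto
    then have "sgn x \<in> C \<inter> sphere 0 1"
      using multicone_sgn[OF C \<open>x \<in> C\<close>] by (simp add: norm_sgn)
    moreover have "sgn (H *v x) = ?f (H, sgn x)"
      using \<open>x \<noteq> 0\<close> by (simp add: sgn_div_norm matrix_vector_mult_scaleR sgn_scaleR)
    ultimately show ?thesis using r(2) \<open>H \<in> K\<close> interior_subset by fastforce
  qed
  then show ?thesis using r(1) by blast
qed

lemma matrix_inv_mult_left: "invertible M \<Longrightarrow> matrix_inv M ** M = mat 1"
  unfolding invertible_def matrix_inv_def by (rule someI2_ex) auto

lemma norm_le_opnorm_matrix_inv: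
  assumes "invertible M"
  shows "norm x \<le> opnorm (matrix_inv M) * norm (M *v x)"
  using opnorm_mult_vec[of "matrix_inv M" "M *v x"] matrix_inv_mult_left[OF assms]
  by (simp add: matrix_vector_mul_assoc)

lemma opnorm_matrix_inv_mult_ge_1:
  assumes "invertible M"
  shows "1 \<le> opnorm (matrix_inv M) * opnorm M"
proof -
  have "1 \<le> opnorm (matrix_inv M) * norm (M *v axis 1 1)"
    using norm_le_opnorm_matrix_inv[OF assms, of "axis 1 1"] by simp
  also have "\<dots> \<le> opnorm (matrix_inv M) * opnorm M"
    using opnorm_mult_vec[of M "axis 1 1"] by (intro mult_left_mono opnorm_nonneg) simp_all
  finally show ?thesis .
qed

definition conformal_wrt :: "mat2 \<Rightarrow> mat2 \<Rightarrow> bool" where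
  "conformal_wrt M E \<longleftrightarrow> (\<exists>s\<ge>0. \<forall>x. norm (M *v (E *v x)) = s * norm (M *v x))"

lemma conformal_wrt_id: "conformal_wrt M (mat 1)"
  unfolding conformal_wrt_def by (intro exI[of _ 1]) simp

lemma conformal_wrt_mult:
  assumes "conformal_wrt M A" "conformal_wrt M B"
  shows "conformal_wrt M (A ** B)"
proof -
  obtain s t where "s \<ge> 0" "\<forall>x. norm (M *v (A *v x)) = s * norm (M *v x)"
    and "t \<ge> 0" "\<forall>x. norm (M *v (B *v x)) = t * norm (M *v x)"
    using assms unfolding conformal_wrt_def by blast
  then show ?thesis
    unfolding conformal_wrt_def
    by (intro exI[of _ "s * t"]) (simp add: matrix_vector_mul_assoc[symmetric])
qed

lemma conformal_wrt_if_orthogonal_conjugate: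
  assumes M: "invertible M"
    and orth: "orthogonal_matrix ((1 / sqrt \<bar>det A\<bar>) *\<^sub>R (M ** A ** matrix_inv M))"
  shows "conformal_wrt M A"
proof -
  define s where "s = sqrt \<bar>det A\<bar>"
  let ?N = "(1 / s) *\<^sub>R (M ** A ** matrix_inv M)"
  have isometry: "norm (?N *v v) = norm v" for v
    using orth unfolding s_def
    by (metis orthogonal_transformation_matrix orthogonal_transformation_norm
        matrix_of_matrix_vector_mul matrix_vector_mul_linear)
  have "s \<noteq> 0"
  proof
    assume "s = 0"
    then have "norm (axis 1 1 :: real^2) = 0" using isometry[of "axis 1 1"] by simp
    then show False by simp
  qed
  have "?N *v (M *v x) = (1 / s) *\<^sub>R (M *v (A *v x))" for x
  proof -
    have "(M ** A ** matrix_inv M) *v (M *v x) = M *v (A *v ((matrix_inv M ** M) *v x))"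
      by (simp add: matrix_vector_mul_assoc matrix_mul_assoc)
    then show ?thesis
      using matrix_inv_mult_left[OF M] by (simp add: scaleR_matrix_vector_assoc[symmetric])
  qed
  then have "norm (M *v (A *v x)) = s * norm (M *v x)" for x
    using isometry[of "M *v x"] \<open>s \<noteq> 0\<close> by (simp add: field_simps s_def)
  then show ?thesis unfolding conformal_wrt_def by (intro exI[of _ s]) (simp add: s_def)
qed

lemma conformal_wrt_scale_bounds:
  assumes M: "invertible M" and s: "0 \<le> s" "\<forall>x. norm (M *v (E *v x)) = s * norm (M *v x)"
  defines "\<kappa> \<equiv> opnorm (matrix_inv M) * opnorm M"
  shows "opnorm E \<le> \<kappa> * s" and "s * norm x \<le> \<kappa> * norm (E *v x)"
proof -
  have b: "0 \<le> opnorm (matrix_inv M)" by (rule opnorm_nonneg)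
  show "opnorm E \<le> \<kappa> * s"
  proof (rule opnorm_le)
    fix v
    have "norm (E *v v) \<le> opnorm (matrix_inv M) * (s * norm (M *v v))"
      using norm_le_opnorm_matrix_inv[OF M, of "E *v v"] s(2) by simp
    also have "\<dots> \<le> opnorm (matrix_inv M) * (s * (opnorm M * norm v))"
      using opnorm_mult_vec[of M v] b s(1) by (intro mult_left_mono) auto
    finally show "norm (E *v v) \<le> \<kappa> * s * norm v" by (simp add: \<kappa>_def ac_simps)
  qed
  have "s * norm x \<le> s * (opnorm (matrix_inv M) * norm (M *v x))"
    using norm_le_opnorm_matrix_inv[OF M] s(1) by (rule mult_left_mono)
  also have "\<dots> = opnorm (matrix_inv M) * norm (M *v (E *v x))" using s(2) by simp
  also have "\<dots> \<le> opnorm (matrix_inv M) * (opnorm M * norm (E *v x))"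
    using opnorm_mult_vec b by (rule mult_left_mono)
  finally show "s * norm x \<le> \<kappa> * norm (E *v x)" by (simp add: \<kappa>_def ac_simps)
qed

lemma conformal_wrt_lower_bound:
  assumes M: "invertible M"
  shows "\<exists>k>0. \<forall>E x. conformal_wrt M E \<longrightarrow> k * opnorm E * norm x \<le> norm (E *v x)"
proof -
  define \<kappa> where "\<kappa> = opnorm (matrix_inv M) * opnorm M"
  have "1 \<le> \<kappa>" unfolding \<kappa>_def using opnorm_matrix_inv_mult_ge_1[OF M] .
  have "1 / \<kappa>\<^sup>2 * opnorm E * norm x \<le> norm (E *v x)" if conf: "conformal_wrt M E" for E x
  proof -
    obtain s where s: "0 \<le> s" "\<forall>x. norm (M *v (E *v x)) = s * norm (M *v x)"
      using conf unfolding conformal_wrt_def by blast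
    have "1 / \<kappa>\<^sup>2 * opnorm E * norm x \<le> 1 / \<kappa>\<^sup>2 * (\<kappa> * s) * norm x"
      using conformal_wrt_scale_bounds(1)[OF M s] unfolding \<kappa>_def
      by (intro mult_right_mono mult_left_mono) auto
    also have "\<dots> = s * norm x / \<kappa>"
      using \<open>1 \<le> \<kappa>\<close> by (simp add: power2_eq_square)
    also have "\<dots> \<le> norm (E *v x)"
      using conformal_wrt_scale_bounds(2)[OF M s, of x] \<open>1 \<le> \<kappa>\<close>
      by (simp add: \<kappa>_def pos_divide_le_eq mult.commute)
    finally show ?thesis .
  qed
  then show ?thesis using \<open>1 \<le> \<kappa>\<close> by (intro exI[of _ "1 / \<kappa>\<^sup>2"]) auto
qed

lemma semigroup_gen_subset:
  assumes "B \<subseteq> X" "\<And>A C. A \<in> X \<Longrightarrow> C \<in> X \<Longrightarrow> A ** C \<in> X"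
  shows "semigroup_gen B \<subseteq> X"
proof
  fix S assume "S \<in> semigroup_gen B"
  then show "S \<in> X" by induction (use assms in auto)
qed

lemma semigroup_gen_image_subset:
  assumes "\<forall>A\<in>B. (*v) A ` C \<subseteq> C" "S \<in> semigroup_gen B"
  shows "(*v) S ` C \<subseteq> C"
  using semigroup_gen_subset[of B "{S. (*v) S ` C \<subseteq> C}"] assms
  by (auto simp: matrix_vector_mul_assoc[symmetric])

lemma semigroup_gen_Un_cases:
  assumes "S \<in> semigroup_gen (A \<union> B)"
  shows "S \<in> semigroup_gen A \<or>
    (\<exists>T H E. T \<in> insert (mat 1) (semigroup_gen (A \<union> B)) \<and> H \<in> B \<and>
      E \<in> insert (mat 1) (semigroup_gen A) \<and> S = T ** H ** E)"
  using assms
proof (induction rule: semigroup_gen.induct)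
  case (gen X)
  show ?case
  proof (cases "X \<in> A")
    case True
    then show ?thesis by (auto intro: semigroup_gen.gen)
  next
    case False
    with gen have "X \<in> B" by blast
    then show ?thesis by (intro disjI2 exI[of _ "mat 1"] exI[of _ X]) simp
  qed
next
  case (mult X Y)
  from mult.IH(2) show ?case
  proof (elim disjE exE conjE)
    assume Y: "Y \<in> semigroup_gen A"
    from mult.IH(1) show ?case
    proof (elim disjE exE conjE)
      assume "X \<in> semigroup_gen A"
      then show ?case using Y by (auto intro: semigroup_gen.mult)
    next
      fix T H E assume TH: "T \<in> insert (mat 1) (semigroup_gen (A \<union> B))" "H \<in> B"
        and "E \<in> insert (mat 1) (semigroup_gen A)" "X = T ** H ** E"
      then have "E ** Y \<in> semigroup_gen A" "X ** Y = T ** H ** (E ** Y)"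
        using Y by (auto intro: semigroup_gen.mult simp: matrix_mul_assoc)
      with TH show ?case by blast
    qed
  next
    fix T H E assume "T \<in> insert (mat 1) (semigroup_gen (A \<union> B))"
      and HE: "H \<in> B" "E \<in> insert (mat 1) (semigroup_gen A)" and "Y = T ** H ** E"
    then have "X ** T \<in> semigroup_gen (A \<union> B)" "X ** Y = (X ** T) ** H ** E"
      using mult.hyps(1) by (auto intro: semigroup_gen.mult simp: matrix_mul_assoc)
    with HE show ?case by blast
  qed
qed

lemma opnorm_triple_product_lower_bound:
  fixes T H E :: mat2
  assumes H: "\<And>x. m * norm x \<le> norm (H *v x)" "opnorm H \<le> b"
    and E: "\<And>x. k * opnorm E * norm x \<le> norm (E *v x)"
    and T: "opnorm T * norm (H *v (E *v w)) \<le> K * norm (T *v (H *v (E *v w)))"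
    and "0 \<le> k" "0 \<le> m"
  shows "k * m * opnorm (T ** H ** E) * norm w \<le> b * K * norm ((T ** H ** E) *v w)"
proof -
  have "0 \<le> b" using H(2) opnorm_nonneg order_trans by blast
  have "opnorm (T ** H ** E) \<le> opnorm T * opnorm H * opnorm E"
    using opnorm_matrix_mult[of "T ** H" E] opnorm_matrix_mult[of T H]
    by (meson mult_right_mono opnorm_nonneg order_trans)
  also have "\<dots> \<le> opnorm T * b * opnorm E"
    using H(2) by (intro mult_right_mono mult_left_mono opnorm_nonneg)
  finally have "k * m * opnorm (T ** H ** E) * norm w \<le> k * m * (opnorm T * b * opnorm E) * norm w"
    using \<open>0 \<le> k\<close> \<open>0 \<le> m\<close> by (intro mult_right_mono mult_left_mono) auto
  also have "\<dots> = b * m * opnorm T * (k * opnorm E * norm w)" by (simp add: ac_simps)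
  also have "\<dots> \<le> b * m * opnorm T * norm (E *v w)"
    using E \<open>0 \<le> b\<close> \<open>0 \<le> m\<close> by (intro mult_left_mono mult_nonneg_nonneg opnorm_nonneg)
  also have "\<dots> = b * opnorm T * (m * norm (E *v w))" by (simp add: ac_simps)
  also have "\<dots> \<le> b * (opnorm T * norm (H *v (E *v w)))"
    using H(1) \<open>0 \<le> b\<close> by (simp add: mult.assoc mult_left_mono opnorm_nonneg)
  also have "\<dots> \<le> b * (K * norm (T *v (H *v (E *v w))))"
    using T \<open>0 \<le> b\<close> by (rule mult_left_mono)
  also have "\<dots> = b * K * norm ((T ** H ** E) *v w)"
    by (simp add: matrix_vector_mul_assoc matrix_mul_assoc)
  finally show ?thesis .
qed

lemma strongly_invariant_factor_expansion:
  assumes "Ah \<subseteq> GL2" "compact Ah" and C: "multicone C" and "strongly_invariant Ah C"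
    and "0 \<le> k"
  shows "\<exists>D\<ge>0. \<forall>T H E w. (*v) T ` C \<subseteq> C \<longrightarrow> H \<in> Ah \<longrightarrow> (*v) E ` C \<subseteq> C \<longrightarrow>
    (\<forall>x. k * opnorm E * norm x \<le> norm (E *v x)) \<longrightarrow> w \<in> C \<longrightarrow>
    k * opnorm (T ** H ** E) * norm w \<le> D * norm ((T ** H ** E) *v w)"
proof -
  obtain m where m: "m > 0" "\<forall>H\<in>Ah. \<forall>x. m * norm x \<le> norm (H *v x)"
    using compact_GL2_uniform_lower_bound[OF assms(2,1)] by blast
  obtain b where b: "b > 0" "\<forall>H\<in>Ah. norm H \<le> b"
    using compact_imp_bounded[OF assms(2)] unfolding bounded_pos by blast
  obtain n c where c: "c > 0" "\<forall>x\<in>C. norm x \<le> c * \<bar>n \<bullet> x\<bar>"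
    using multicone_norm_le_functional[OF C] by blast
  obtain r where r: "r > 0" "\<forall>H\<in>Ah. \<forall>x\<in>C. ball (sgn (H *v x)) r \<subseteq> C"
    using strongly_invariant_uniform_ball[OF C assms(4,2,1)] by blast
  define K where "K = 2 * c * norm n / r"
  have "k * opnorm (T ** H ** E) * norm w \<le> 4 * b * K / m * norm ((T ** H ** E) *v w)"
    if T: "(*v) T ` C \<subseteq> C" and "H \<in> Ah" "(*v) E ` C \<subseteq> C" "w \<in> C"
      and E: "\<forall>x. k * opnorm E * norm x \<le> norm (E *v x)" for T H E w
  proof -
    have "E *v w \<in> C" using that by blast
    then have "ball (sgn (H *v (E *v w))) r \<subseteq> C" using r(2) \<open>H \<in> Ah\<close> by blast
    then have "opnorm T * norm (H *v (E *v w)) \<le> K * norm (T *v (H *v (E *v w)))"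
      unfolding K_def using T c r multicone_zero[OF C]
      by (intro opnorm_mult_norm_le_at_interior_direction) auto
    then have "k * m * opnorm (T ** H ** E) * norm w \<le> 4 * b * K * norm ((T ** H ** E) *v w)"
      using m b \<open>H \<in> Ah\<close> E \<open>0 \<le> k\<close>
      by (intro opnorm_triple_product_lower_bound) (auto intro: order_trans[OF opnorm_le_norm])
    then show ?thesis using m(1) by (simp add: field_simps)
  qed
  moreover have "0 \<le> 4 * b * K / m" unfolding K_def using b c r m by simp
  ultimately show ?thesis by blast
qed

lemma semigroup_uniformly_expanding_on_multicone:
  assumes "Ah \<subseteq> GL2" "compact Ah" and C: "multicone C" and "strongly_invariant Ah C"
    and "strongly_conformal Ae" and Ae_C: "\<forall>A\<in>Ae. (*v) A ` C \<subseteq> C"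
  shows "\<exists>c>0. \<forall>S\<in>semigroup_gen (Ae \<union> Ah). \<forall>w\<in>C. c * opnorm S * norm w \<le> norm (S *v w)"
proof -
  have Ah_C: "\<forall>H\<in>Ah. (*v) H ` C \<subseteq> C"
    using assms(4) interior_subset unfolding strongly_invariant_def by blast
  obtain M :: mat2 where M: "invertible M"
    and orth: "\<forall>A\<in>Ae. orthogonal_matrix ((1 / sqrt \<bar>det A\<bar>) *\<^sub>R (M ** A ** matrix_inv M))"
    using assms(5) unfolding strongly_conformal_def by blast
  have Ae_conformal: "semigroup_gen Ae \<subseteq> Collect (conformal_wrt M)"
    using orth conformal_wrt_if_orthogonal_conjugate[OF M] conformal_wrt_mult
    by (intro semigroup_gen_subset) auto
  obtain k where k: "k > 0" "\<forall>E x. conformal_wrt M E \<longrightarrow> k * opnorm E * norm x \<le> norm (E *v x)"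
    using conformal_wrt_lower_bound[OF M] by blast
  obtain D where D: "D \<ge> 0" "\<forall>T H E w. (*v) T ` C \<subseteq> C \<longrightarrow> H \<in> Ah \<longrightarrow> (*v) E ` C \<subseteq> C \<longrightarrow>
      (\<forall>x. k * opnorm E * norm x \<le> norm (E *v x)) \<longrightarrow> w \<in> C \<longrightarrow>
      k * opnorm (T ** H ** E) * norm w \<le> D * norm ((T ** H ** E) *v w)"
    using strongly_invariant_factor_expansion[OF assms(1-4), of k] k(1) by auto
  define c where "c = min k (k / (D + 1))"
  have "c * opnorm S * norm w \<le> norm (S *v w)"
    if S: "S \<in> semigroup_gen (Ae \<union> Ah)" and "w \<in> C" for S w
    using semigroup_gen_Un_cases[OF S]
  proof (elim disjE exE conjE)
    assume "S \<in> semigroup_gen Ae"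
    then have "k * opnorm S * norm w \<le> norm (S *v w)" using Ae_conformal k(2) by blast
    then show ?thesis
      using mult_right_mono[of c k "opnorm S * norm w"] opnorm_nonneg[of S]
      by (simp add: c_def mult.assoc)
  next
    fix T H E assume T: "T \<in> insert (mat 1) (semigroup_gen (Ae \<union> Ah))" and "H \<in> Ah"
      and E: "E \<in> insert (mat 1) (semigroup_gen Ae)" and S_eq: "S = T ** H ** E"
    have "(*v) T ` C \<subseteq> C"
      using T Ae_C Ah_C semigroup_gen_image_subset[of "Ae \<union> Ah" C T] by auto
    moreover have "(*v) E ` C \<subseteq> C" "conformal_wrt M E"
      using E Ae_C semigroup_gen_image_subset[of Ae C E] Ae_conformal conformal_wrt_id by auto
    ultimately have bound: "k * opnorm S * norm w \<le> D * norm (S *v w)"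
      using D(2) k(2) \<open>H \<in> Ah\<close> \<open>w \<in> C\<close> unfolding S_eq by blast
    have "c * opnorm S * norm w \<le> k / (D + 1) * opnorm S * norm w"
      unfolding c_def by (intro mult_right_mono opnorm_nonneg) auto
    also have "\<dots> = k * opnorm S * norm w / (D + 1)" by simp
    also have "\<dots> \<le> D * norm (S *v w) / (D + 1)"
      using bound D(1) by (intro divide_right_mono) auto
    also have "\<dots> \<le> norm (S *v w)"
      using D(1) by (simp add: divide_le_eq algebra_simps)
    finally show ?thesis .
  qed
  moreover have "c > 0" unfolding c_def using k D(1) by simp
  ultimately show ?thesis by blast
qed

lemma almost_multiplicative_if_expanding_on_cone:
  assumes "w \<in> C" "w \<noteq> 0" "c > 0"
    and preserves: "\<forall>S\<in>X. (*v) S ` C \<subseteq> C"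
    and expanding: "\<forall>S\<in>X. \<forall>w\<in>C. c * opnorm S * norm w \<le> norm (S *v w)"
  shows "almost_multiplicative X"
proof -
  have "c * c * opnorm A * opnorm B \<le> opnorm (A ** B)" if "A \<in> X" "B \<in> X" for A B
  proof -
    have "c * c * opnorm A * opnorm B * norm w = c * opnorm A * (c * opnorm B * norm w)"
      by (simp add: ac_simps)
    also have "\<dots> \<le> c * opnorm A * norm (B *v w)"
      using expanding that \<open>w \<in> C\<close> \<open>c > 0\<close> by (intro mult_left_mono mult_nonneg_nonneg opnorm_nonneg) auto
    also have "\<dots> \<le> norm (A *v (B *v w))"
      using expanding preserves that \<open>w \<in> C\<close> by blast
    also have "\<dots> \<le> opnorm (A ** B) * norm w"
      using opnorm_mult_vec by (simp add: matrix_vector_mul_assoc)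
    finally show ?thesis using \<open>w \<noteq> 0\<close> by simp
  qed
  then show ?thesis
    unfolding almost_multiplicative_def using \<open>c > 0\<close> by (intro exI[of _ "c * c"]) auto
qed

theorem proposition2p3:
  fixes Ae Ah :: "mat2 set" and C :: "(real^2) set"
  assumes "Ae \<subseteq> GL2" and "Ah \<subseteq> GL2"
    and "Ah \<noteq> {}" and "compact Ah"
    and "multicone C" and "strongly_invariant Ah C"
    and "strongly_conformal Ae"
    and "\<forall>A\<in>Ae. (\<lambda>x. A *v x) ` C = C"
  shows "almost_multiplicative (semigroup_gen (Ae \<union> Ah))"
proof -
  have preserves: "\<forall>A\<in>Ae \<union> Ah. (*v) A ` C \<subseteq> C"
    using assms(6,8) interior_subset unfolding strongly_invariant_def by blast
  then obtain c where "c > 0"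
    and "\<forall>S\<in>semigroup_gen (Ae \<union> Ah). \<forall>w\<in>C. c * opnorm S * norm w \<le> norm (S *v w)"
    using semigroup_uniformly_expanding_on_multicone[OF assms(2,4-7)] by blast
  moreover obtain w where "w \<in> C" "norm w = 1"
    using multicone_unit_vector[OF assms(5)] by blast
  ultimately show ?thesis
    using semigroup_gen_image_subset[OF preserves]
    by (intro almost_multiplicative_if_expanding_on_cone[of w C]) auto
qed

end
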